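(* Let $n>1$ be an integer and let $a,b\in\mathbb Z_n$ be incomparable with respect to $\leq$. Let $d=\gcd(\gcd(a-1,b-1),n)$. Then the meet $a\wedge b$ (greatest lower bound of $\{a,b\}$) exists in $(\mathbb Z_n,\leq)$ if and only if the ideal $(n/d)$ of $\mathbb Z_n$ has a largest element with respect to $\leq$.
   Context: On $\mathbb Z_n$ define the partial order $\leq$ by: $a\leq b$ iff $a=b$ or $a\equiv ab\pmod n$. For $x\in\mathbb Z_n$, $(x)$ denotes the ideal of $\mathbb Z_n$ generated by $x$. Gcds are taken of integer representatives. *)

theory Defs
  imports "HOL-Number_Theory.Residues" "HOL-Algebra.Ideal" "HOL-Algebra.Order"
begin

definition zn_order :: "int \<Rightarrow> int gorder" where
  "zn_order n =
     \<lparr>carrier = carrier (residue_ring n),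
      eq = (=),
      le = (\<lambda>a b. a = b \<or> [a = a * b] (mod n))\<rparr>"

lemma partial_order_zn_order:
  "partial_order (zn_order n)"
proof
  fix x y
  assume xy: "x \<sqsubseteq>\<^bsub>zn_order n\<^esub> y" "y \<sqsubseteq>\<^bsub>zn_order n\<^esub> x"
    and c: "x \<in> carrier (zn_order n)" "y \<in> carrier (zn_order n)"
  have "[x = y] (mod n)"
    using xy by (auto simp: zn_order_def) (metis cong_sym cong_trans mult.commute)
  then show "x .=\<^bsub>zn_order n\<^esub> y"
    using c by (auto simp: zn_order_def residue_ring_def cong_def)
next
  fix x y z
  assume xy: "x \<sqsubseteq>\<^bsub>zn_order n\<^esub> y" and yz: "y \<sqsubseteq>\<^bsub>zn_order n\<^esub> z"
  show "x \<sqsubseteq>\<^bsub>zn_order n\<^esub> z"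
  proof (cases "x = y \<or> y = z")
    case True
    then show ?thesis using xy yz by auto
  next
    case False
    then have 1: "[x = x * y] (mod n)" and 2: "[y = y * z] (mod n)"
      using xy yz by (auto simp: zn_order_def)
    have "[x * y = x * (y * z)] (mod n)"
      using 2 by (rule cong_scalar_left)
    moreover have "[x * z = x * y * z] (mod n)"
      using 1 by (rule cong_scalar_right)
    ultimately have "[x = x * z] (mod n)"
      using 1 by (metis cong_sym cong_trans mult.assoc)
    then show ?thesis by (simp add: zn_order_def)
  qed
qed (auto simp: zn_order_def)

end

theory Submission
  imports Defs
begin

text \<open>
  An element \<open>c\<close> is a lower bound of \<open>x \<noteq> c\<close> iff \<open>c (x - 1) \<equiv> 0\<close>. If \<open>A\<close> has no least element, then
  no lower bound of \<open>A\<close> lies in \<open>A\<close>, so the lower bounds are exactly the \<open>c\<close> with \<open>n dvd c * d\<close>,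
  where \<open>d\<close> is the gcd of \<open>n\<close> and all \<open>x - 1\<close>. These are the multiples of \<open>n div d\<close>, that is, the
  ideal \<open>(n div d)\<close>, whose largest element is the meet of \<open>A\<close> by definition.
\<close>

lemma (in semiring_Gcd) dvd_mult_Gcd_iff:
  "k dvd c * Gcd A \<longleftrightarrow> (\<forall>x\<in>A. k dvd c * x)"
proof -
  have "k dvd c * Gcd A \<longleftrightarrow> k dvd Gcd ((*) c ` A)"
    by (simp add: Gcd_mult)
  also have "\<dots> \<longleftrightarrow> (\<forall>x\<in>A. k dvd c * x)"
    by (simp add: dvd_Gcd_iff)
  finally show ?thesis .
qed

lemma div_Gcd_insert_dvd_iff:
  fixes n c :: "'a :: semiring_Gcd"
  assumes "n \<noteq> 0"
  shows "n div Gcd (insert n A) dvd c \<longleftrightarrow> (\<forall>x\<in>A. n dvd c * x)"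
proof -
  have "n div Gcd (insert n A) dvd c \<longleftrightarrow> n dvd c * Gcd (insert n A)"
    using assms by (intro div_dvd_iff_mult) auto
  also have "\<dots> \<longleftrightarrow> (\<forall>x\<in>A. n dvd c * x)"
    by (simp add: dvd_mult_Gcd_iff del: Gcd_insert)
  finally show ?thesis .
qed

lemma (in residues) genideal_mod_eq_multiples_gcd:
  "Idl {e mod m} = {c \<in> carrier R. gcd e m dvd c}"
proof -
  have "Idl {e mod m} = PIdl (e mod m)"
    by (simp add: cgenideal_eq_genideal)
  also have "\<dots> = {c \<in> carrier R. gcd e m dvd c}"
  proof (intro equalityI subsetI)
    fix c
    assume "c \<in> PIdl (e mod m)"
    then obtain y where "c = y * e mod m"
      by (auto simp: cgenideal_def res_mult_eq mod_mult_right_eq)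
    then show "c \<in> {c \<in> carrier R. gcd e m dvd c}"
      by (simp add: dvd_mod)
  next
    fix c
    assume c_multiple: "c \<in> {c \<in> carrier R. gcd e m dvd c}"
    then obtain y where "[e * y = c] (mod m)"
      using cong_solve_dvd_int by blast
    with c_multiple have "c = (y mod m) \<otimes> (e mod m)"
      by (simp add: res_mult_eq res_carrier_eq cong_def mod_mult_eq mult.commute)
    then show "c \<in> PIdl (e mod m)"
      by (auto simp: cgenideal_def)
  qed
  finally show ?thesis .
qed

lemma zn_order_le_iff:
  "c \<sqsubseteq>\<^bsub>zn_order n\<^esub> x \<longleftrightarrow> c = x \<or> n dvd c * (x - 1)"
  by (simp add: zn_order_def cong_iff_dvd_diff dvd_diff_commute[of n c] right_diff_distrib)

lemma Lower_zn_order_no_least: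
  assumes "n \<noteq> 0" and A_subset: "A \<subseteq> carrier (residue_ring n)"
    and no_least: "\<nexists>l. least (zn_order n) l A"
  shows "Lower (zn_order n) A =
    {c \<in> carrier (residue_ring n). n div Gcd (insert n ((\<lambda>x. x - 1) ` A)) dvd c}"
proof -
  have carrier_zn_order: "carrier (zn_order n) = carrier (residue_ring n)"
    by (simp add: zn_order_def)
  have "c \<notin> A" if "\<forall>x\<in>A. c \<sqsubseteq>\<^bsub>zn_order n\<^esub> x" for c
    using no_least that A_subset by (auto simp: least_def carrier_zn_order)
  then have "(\<forall>x\<in>A. c \<sqsubseteq>\<^bsub>zn_order n\<^esub> x) \<longleftrightarrow> (\<forall>x\<in>A. n dvd c * (x - 1))" for c
    by (metis zn_order_le_iff)
  also have "(\<forall>x\<in>A. n dvd c * (x - 1)) \<longleftrightarrow> n div Gcd (insert n ((\<lambda>x. x - 1) ` A)) dvd c" for c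
    using \<open>n \<noteq> 0\<close> by (simp add: div_Gcd_insert_dvd_iff del: Gcd_insert)
  finally show ?thesis
    using A_subset by (auto simp: Lower_def carrier_zn_order)
qed

theorem theorem3p3:
  fixes n a b d :: int
  assumes "n > 1"
    and "a \<in> carrier (residue_ring n)"
    and "b \<in> carrier (residue_ring n)"
    and "\<not> a \<sqsubseteq>\<^bsub>zn_order n\<^esub> b"
    and "\<not> b \<sqsubseteq>\<^bsub>zn_order n\<^esub> a"
    and "d = gcd (gcd (a - 1) (b - 1)) n"
  shows "(\<exists>m. is_glb (zn_order n) m {a, b}) \<longleftrightarrow>
         (\<exists>g. greatest (zn_order n) g (Idl\<^bsub>residue_ring n\<^esub> {(n div d) mod n}))"
proof -
  interpret residues n "residue_ring n"
    using \<open>n > 1\<close> by unfold_locales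
  have d_eq_Gcd: "d = Gcd (insert n ((\<lambda>x. x - 1) ` {a, b}))"
    using assms(6) by (simp add: ac_simps)
  have "\<nexists>l. least (zn_order n) l {a, b}"
    using assms(4,5) by (auto simp: least_def)
  then have "Lower (zn_order n) {a, b} = {c \<in> carrier (residue_ring n). n div d dvd c}"
    using assms(1-3) unfolding d_eq_Gcd by (intro Lower_zn_order_no_least) auto
  moreover have "n div d dvd n"
    using assms(1,6) by (simp add: div_dvd_iff_mult)
  then have "Idl\<^bsub>residue_ring n\<^esub> {(n div d) mod n} =
      {c \<in> carrier (residue_ring n). n div d dvd c}"
    by (simp add: genideal_mod_eq_multiples_gcd gcd_proj1_if_dvd)
  ultimately show ?thesis
    by simp
qed

end
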